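(* Let $n \geq 2$ and let $n^2 \cdot S^1_4$ denote the disjoint union of $n^2$ copies of the sunlet $S^1_4$. Then there is a homomorphism $\varphi: n^2 \cdot S^1_4 \to C_{2n} \,\Box\, C_{2n}$ which is a covering and is 2-to-1 on vertices, such that the restriction of $\varphi$ to the disjoint union of the $n^2$ cycles $Z(S^1_4)$ is an isomorphism onto the union of the odd squares, and $\varphi$ is compatible with the FSM orientation of $n^2 \cdot S^1_4$ and the raster orientation of $C_{2n} \,\Box\, C_{2n}$.
   Context: For $p \geq 3$, the sunlet $S^1_p$ is the graph obtained from a cycle $C_p$ by attaching one pendant edge at each vertex of the cycle ($2p$ vertices, $2p$ edges); $Z(S)$ denotes the unique cycle of a sunlet $S$. View $C_{2n} \,\Box\, C_{2n}$ as a $2n \times 2n$ square grid with opposite sides identified: vertices $(r,c)$ with row index $r$ and column index $c$ in $\{1,\dots,2n\}$ taken mod $2n$ (rows numbered from top to bottom, columns from left to right), row edges $\{(r,c),(r,c+1)\}$ and column edges $\{(r,c),(r+1,c)\}$. The raster orientation directs all odd-indexed rows left-to-right ($(r,c)\to(r,c+1)$ for $r$ odd), all even-indexed rows right-to-left ($(r,c+1)\to(r,c)$ for $r$ even), all odd-indexed columns bottom-to-top ($(r+1,c)\to(r,c)$ for $c$ odd), and all even-indexed columns top-to-bottom ($(r,c)\to(r+1,c)$ for $c$ even). Call the edges $\{1,2\},\{3,4\},\dots,\{2n-1,2n\}$ of $C_{2n}$ (on vertices $1,\dots,2n$) its odd-indexed edges; the odd squares are the $n^2$ vertex-disjoint 4-cycles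 obtained as products of two odd-indexed edges, i.e. for $k,l \in \{0,\dots,n-1\}$ the 4-cycle $(2k+1,2l+1),(2k+1,2l+2),(2k+2,2l+2),(2k+2,2l+1)$; each is a directed cycle in the raster orientation. A homomorphism $\varphi: G \to H$ is a map $V(G)\to V(H)$ sending edges to edges; it is a covering if the induced map on edge sets is a bijection; it is 2-to-1 on vertices if every vertex of $H$ has exactly two preimages. The FSM orientation of a sunlet orients its cycle as a directed cycle and each pendant edge from its degree-1 vertex toward the cycle vertex; on a disjoint union of sunlets each component is so oriented. $\varphi$ is compatible with orientations if $(\varphi(u),\varphi(w))$ is an arc whenever $(u,w)$ is an arc. *)

theory Defs
  imports Main
begin

record 'a ugraph =
  verts :: "'a set"
  edges :: "'a set set"

text \<open>Successor on \<open>{1..m}\<close> read modulo \<open>m\<close>.\<close>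

definition cyc_suc :: "nat \<Rightarrow> nat \<Rightarrow> nat" where
  "cyc_suc m i = (if i = m then 1 else i + 1)"

definition cycle_graph :: "nat \<Rightarrow> nat ugraph" where
  "cycle_graph m = \<lparr>verts = {1..m}, edges = {{i, cyc_suc m i} | i. i \<in> {1..m}}\<rparr>"

definition box_product :: "'a ugraph \<Rightarrow> 'b ugraph \<Rightarrow> ('a \<times> 'b) ugraph" (infixr "\<box>" 70) where
  "G \<box> H = \<lparr>verts = verts G \<times> verts H,
     edges = {{(a, b), (a, b')} | a b b'. a \<in> verts G \<and> {b, b'} \<in> edges H}
           \<union> {{(a, b), (a', b)} | a a' b. {a, a'} \<in> edges G \<and> b \<in> verts H}\<rparr>"

text \<open>\<open>copies N G\<close> is the disjoint union of \<open>N\<close> copies of \<open>G\<close>, copy number \<open>j\<close> being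
  tagged with \<open>j\<close>; \<open>copies_arcs\<close> does the same with a set of arcs.\<close>

definition copies :: "nat \<Rightarrow> 'a ugraph \<Rightarrow> (nat \<times> 'a) ugraph" where
  "copies N G = \<lparr>verts = {1..N} \<times> verts G,
     edges = {Pair j ` e | j e. j \<in> {1..N} \<and> e \<in> edges G}\<rparr>"

definition copies_arcs :: "nat \<Rightarrow> ('a \<times> 'a) set \<Rightarrow> ((nat \<times> 'a) \<times> (nat \<times> 'a)) set" where
  "copies_arcs N A = {((j, u), (j, w)) | j u w. j \<in> {1..N} \<and> (u, w) \<in> A}"

text \<open>\<open>Leaf i\<close> is the degree-1 vertex attached to the vertex \<open>Rim i\<close> of the cycle.\<close>

datatype sunlet_vertex = Rim nat | Leaf nat

definition sunlet_cycle :: "nat \<Rightarrow> sunlet_vertex ugraph" where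
  "sunlet_cycle p = \<lparr>verts = Rim ` verts (cycle_graph p), edges = (`) Rim ` edges (cycle_graph p)\<rparr>"

definition sunlet :: "nat \<Rightarrow> sunlet_vertex ugraph" where
  "sunlet p = \<lparr>verts = verts (sunlet_cycle p) \<union> Leaf ` {1..p},
     edges = edges (sunlet_cycle p) \<union> {{Leaf i, Rim i} | i. i \<in> {1..p}}\<rparr>"

text \<open>The two directions of the rim are exchanged by a reflection of the sunlet; we fix one.\<close>

definition fsm_orientation :: "nat \<Rightarrow> (sunlet_vertex \<times> sunlet_vertex) set" where
  "fsm_orientation p = {(Rim i, Rim (cyc_suc p i)) | i. i \<in> {1..p}}
                     \<union> {(Leaf i, Rim i) | i. i \<in> {1..p}}"

text \<open>Vertex \<open>(r, c)\<close>: row index \<open>r\<close> (top to bottom), column index \<open>c\<close> (left to right).\<close>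

definition torus_grid :: "nat \<Rightarrow> (nat \<times> nat) ugraph" where
  "torus_grid n = cycle_graph (2 * n) \<box> cycle_graph (2 * n)"

definition raster_orientation :: "nat \<Rightarrow> ((nat \<times> nat) \<times> (nat \<times> nat)) set" where
  "raster_orientation n = (let I = {1..2 * n}; s = cyc_suc (2 * n) in
       {((r, c), (r, s c)) | r c. r \<in> I \<and> c \<in> I \<and> odd r}
     \<union> {((r, s c), (r, c)) | r c. r \<in> I \<and> c \<in> I \<and> even r}
     \<union> {((s r, c), (r, c)) | r c. r \<in> I \<and> c \<in> I \<and> odd c}
     \<union> {((r, c), (s r, c)) | r c. r \<in> I \<and> c \<in> I \<and> even c})"

text \<open>\<open>odd_edge k\<close> is the \<open>(2k+1)\<close>-st edge of \<open>C\<^bsub>2n\<^esub>\<close>, viewed as a graph.\<close>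

definition odd_edge :: "nat \<Rightarrow> nat ugraph" where
  "odd_edge k = \<lparr>verts = {2 * k + 1, 2 * k + 2}, edges = {{2 * k + 1, 2 * k + 2}}\<rparr>"

definition odd_square :: "nat \<Rightarrow> nat \<Rightarrow> (nat \<times> nat) ugraph" where
  "odd_square k l = odd_edge k \<box> odd_edge l"

definition odd_squares :: "nat \<Rightarrow> (nat \<times> nat) ugraph" where
  "odd_squares n = \<lparr>verts = (\<Union>k<n. \<Union>l<n. verts (odd_square k l)),
     edges = (\<Union>k<n. \<Union>l<n. edges (odd_square k l))\<rparr>"

definition graph_hom :: "'a ugraph \<Rightarrow> 'b ugraph \<Rightarrow> ('a \<Rightarrow> 'b) \<Rightarrow> bool" where
  "graph_hom G H \<phi> \<longleftrightarrow> \<phi> ` verts G \<subseteq> verts H \<and> (\<forall>e\<in>edges G. \<phi> ` e \<in> edges H)"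

text \<open>A covering covers every edge exactly once; this is not the topological notion of a
  local isomorphism. It is meant for a \<open>\<phi>\<close> that is already a homomorphism.\<close>

definition covering :: "'a ugraph \<Rightarrow> 'b ugraph \<Rightarrow> ('a \<Rightarrow> 'b) \<Rightarrow> bool" where
  "covering G H \<phi> \<longleftrightarrow> bij_betw ((`) \<phi>) (edges G) (edges H)"

definition two_to_one :: "'a ugraph \<Rightarrow> 'b ugraph \<Rightarrow> ('a \<Rightarrow> 'b) \<Rightarrow> bool" where
  "two_to_one G H \<phi> \<longleftrightarrow> (\<forall>w\<in>verts H. card {v \<in> verts G. \<phi> v = w} = 2)"

definition graph_iso :: "'a ugraph \<Rightarrow> 'b ugraph \<Rightarrow> ('a \<Rightarrow> 'b) \<Rightarrow> bool" where
  "graph_iso G H \<phi> \<longleftrightarrow> bij_betw \<phi> (verts G) (verts H) \<and>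
     (\<forall>u\<in>verts G. \<forall>v\<in>verts G. {u, v} \<in> edges G \<longleftrightarrow> {\<phi> u, \<phi> v} \<in> edges H)"

definition compatible :: "('a \<times> 'a) set \<Rightarrow> ('b \<times> 'b) set \<Rightarrow> ('a \<Rightarrow> 'b) \<Rightarrow> bool" where
  "compatible A B \<phi> \<longleftrightarrow> (\<forall>(u, w)\<in>A. (\<phi> u, \<phi> w) \<in> B)"

end

theory Submission
  imports Defs
begin

text \<open>In the raster orientation every vertex has exactly one incoming row edge and one incoming
  column edge, so the edges of the torus are indexed by pairs of a vertex and a direction. Wrap the
  rims around the odd squares, which partition the vertices: at each vertex one of the two incoming
  edges lies on its odd square, and the other becomes the image of the pendant edge. The resulting
  map from a vertex to the tail of its pendant edge permutes the vertices of the torus.\<close>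

definition cyc_pred :: "nat \<Rightarrow> nat \<Rightarrow> nat" where
  "cyc_pred m i = (if i = 1 then m else i - 1)"

text \<open>Odd rows are directed rightwards, so the row arc into a vertex comes from the left
  there. Odd columns are directed upwards, that is towards smaller row indices, which is why
  \<open>col_in\<close> takes the successor at odd columns.\<close>

fun row_in :: "nat \<Rightarrow> nat \<times> nat \<Rightarrow> nat \<times> nat" where
  "row_in m (r, c) = (r, if odd r then cyc_pred m c else cyc_suc m c)"

fun col_in :: "nat \<Rightarrow> nat \<times> nat \<Rightarrow> nat \<times> nat" where
  "col_in m (r, c) = (if odd c then cyc_suc m r else cyc_pred m r, c)"

text \<open>The in-neighbour of a vertex outside its own odd square.\<close>

definition off_square :: "nat \<Rightarrow> nat \<times> nat \<Rightarrow> nat \<times> nat" where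
  "off_square m v = (if odd (fst v) = odd (snd v) then row_in m v else col_in m v)"

text \<open>Rim vertices \<open>1, 2, 3, 4\<close> go clockwise from the top left corner, as the raster
  orientation does on odd squares.\<close>

definition rim_pos :: "nat \<Rightarrow> nat \<times> nat \<Rightarrow> nat \<times> nat" where
  "rim_pos n = (\<lambda>(j, i). (2 * ((j - 1) div n) + (if i \<le> 2 then 1 else 2),
                          2 * ((j - 1) mod n) + (if i = 1 \<or> i = 4 then 1 else 2)))"

fun sunlet_map :: "nat \<Rightarrow> nat \<times> sunlet_vertex \<Rightarrow> nat \<times> nat" where
  "sunlet_map n (j, Rim i) = rim_pos n (j, i)"
| "sunlet_map n (j, Leaf i) = off_square (2 * n) (rim_pos n (j, i))"

section \<open>Cyclic successor and predecessor\<close>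

lemma cyc_suc_in: "i \<in> {1..m} \<Longrightarrow> cyc_suc m i \<in> {1..m}"
  by (auto simp: cyc_suc_def)

lemma cyc_pred_in: "i \<in> {1..m} \<Longrightarrow> cyc_pred m i \<in> {1..m}"
  by (auto simp: cyc_pred_def)

lemma cyc_suc_pred: "i \<in> {1..m} \<Longrightarrow> cyc_suc m (cyc_pred m i) = i"
  by (auto simp: cyc_suc_def cyc_pred_def)

lemma cyc_pred_suc: "i \<in> {1..m} \<Longrightarrow> cyc_pred m (cyc_suc m i) = i"
  by (auto simp: cyc_suc_def cyc_pred_def)

text \<open>For even \<open>m\<close> the wrap from \<open>m\<close> to 1 changes parity like every
  other step.\<close>

lemma even_cyc_suc: "i \<in> {1..m} \<Longrightarrow> even m \<Longrightarrow> even (cyc_suc m i) \<longleftrightarrow> odd i"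
  by (auto simp: cyc_suc_def)

lemma even_cyc_pred: "i \<in> {1..m} \<Longrightarrow> even m \<Longrightarrow> even (cyc_pred m i) \<longleftrightarrow> odd i"
  by (auto simp: cyc_pred_def)

text \<open>This fails for \<open>m = 2\<close>, where both steps use the same pair of vertices. It
  keeps parallel edges of the torus distinct and is what calls for \<open>n \<ge> 2\<close>.\<close>

lemma cyc_suc_suc_neq: "i \<in> {1..m} \<Longrightarrow> m > 2 \<Longrightarrow> cyc_suc m (cyc_suc m i) \<noteq> i"
  by (auto simp: cyc_suc_def split: if_splits)

lemma cyc_pred_pred_neq: "i \<in> {1..m} \<Longrightarrow> m > 2 \<Longrightarrow> cyc_pred m (cyc_pred m i) \<noteq> i"
  by (auto simp: cyc_pred_def split: if_splits)

lemma cyc_suc_neq: "m > 1 \<Longrightarrow> cyc_suc m i \<noteq> i"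
  by (auto simp: cyc_suc_def)

lemma cyc_pred_neq: "i \<in> {1..m} \<Longrightarrow> m > 1 \<Longrightarrow> cyc_pred m i \<noteq> i"
  by (auto simp: cyc_pred_def)

section \<open>Numbering the odd squares and their corners\<close>

text \<open>Base \<open>n\<close> digits of \<open>j - 1\<close>; the shift is there because copies
  are numbered from 1. The two digits locate the odd square that copy \<open>j\<close> wraps
  around.\<close>

lemma index_bij:
  "bij_betw (\<lambda>j. ((j - 1) div n, (j - 1) mod n)) {1..n\<^sup>2} ({..<n} \<times> {..<n::nat})"
proof (rule bij_betw_byWitness[where f' = "\<lambda>(k, l). n * k + l + 1"])
  show "(\<lambda>j. ((j - 1) div n, (j - 1) mod n)) ` {1..n\<^sup>2} \<subseteq> {..<n} \<times> {..<n}"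
  proof clarify
    fix j assume "j \<in> {1..n\<^sup>2}"
    then have "j - 1 < n * n" "n > 0"
      by (auto simp: power2_eq_square intro: Nat.gr0I)
    then show "(j - 1) div n \<in> {..<n} \<and> (j - 1) mod n \<in> {..<n}"
      by (simp add: less_mult_imp_div_less)
  qed
  show "(\<lambda>(k, l). n * k + l + 1) ` ({..<n} \<times> {..<n}) \<subseteq> {1..n\<^sup>2}"
  proof clarify
    fix k l assume "k < n" "l < n"
    then have "n * Suc k \<le> n * n" by (intro mult_le_mono2) simp
    with \<open>l < n\<close> show "n * k + l + 1 \<in> {1..n\<^sup>2}"
      by (simp add: power2_eq_square)
  qed
qed (auto simp: ac_simps)

text \<open>The odd squares partition the vertices. Injectivity is read off from the coordinates,
  and surjectivity follows by counting, both sides having \<open>4 * n * n\<close> elements.\<close>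

lemma rim_pos_bij:
  "bij_betw (rim_pos n) ({1..n\<^sup>2} \<times> {1..4}) ({1..2 * n} \<times> {1..2 * n})"
proof -
  have inj: "inj_on (rim_pos n) ({1..n\<^sup>2} \<times> {1..4})"
  proof (rule inj_onI, clarify)
    fix j i j' i'
    assume j: "j \<in> {1..n\<^sup>2}" "j' \<in> {1..n\<^sup>2}" and i: "i \<in> {1..4}" "i' \<in> {1..4}"
      and eq: "rim_pos n (j, i) = rim_pos n (j', i')"
    \<comment> \<open>A positive coordinate determines its block of two consecutive indices and its
      place in the block. The two place tests in \<open>rim_pos\<close> together determine the
      corner \<open>i\<close> in \<open>{1..4}\<close>.\<close>
    have *: "k = k' \<and> (P \<longleftrightarrow> Q)"
      if "2 * k + (if P then 1 else 2) = 2 * k' + (if Q then 1 else 2)" for k k' :: nat and P Q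
      using that by (auto split: if_splits) presburger+
    have "(j - 1) div n = (j' - 1) div n \<and> (i \<le> 2 \<longleftrightarrow> i' \<le> 2)"
      "(j - 1) mod n = (j' - 1) mod n \<and> (i = 1 \<or> i = 4 \<longleftrightarrow> i' = 1 \<or> i' = 4)"
      using eq unfolding rim_pos_def prod.case prod.inject by (intro *; blast)+
    moreover have "j = j'"
      using inj_onD[OF bij_betw_imp_inj_on[OF index_bij] _ j] calculation by simp
    ultimately show "j = j' \<and> i = i'" using i by auto
  qed
  have "rim_pos n ` ({1..n\<^sup>2} \<times> {1..4}) \<subseteq> {1..2 * n} \<times> {1..2 * n}"
  proof (rule image_subsetI)
    fix x assume "x \<in> {1..n\<^sup>2} \<times> {1..4::nat}"
    then obtain j i where x: "x = (j, i)" and "j \<in> {1..n\<^sup>2}" by blast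
    then obtain k l where kl: "(j - 1) div n = k" "(j - 1) mod n = l" "k < n" "l < n"
      using bij_betw_apply[OF index_bij] by blast
    then show "rim_pos n x \<in> {1..2 * n} \<times> {1..2 * n}"
      unfolding x rim_pos_def prod.case kl(1,2) by auto
  qed
  then have "rim_pos n ` ({1..n\<^sup>2} \<times> {1..4}) = {1..2 * n} \<times> {1..2 * n}"
    by (rule card_subset_eq[rotated])
      (simp_all only: card_image[OF inj] card_cartesian_product card_atLeastAtMost
        finite_cartesian_product finite_atLeastAtMost, simp add: power2_eq_square)
  with inj show ?thesis by (simp add: bij_betw_def)
qed

section \<open>In-neighbours on the torus\<close>

text \<open>A step changes the parity of exactly one coordinate, so \<open>off_square\<close>
  exchanges the vertices with coordinates of equal parity and the others. Hence the parities of the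
  image tell whether the step was along a row or a column, and the direction too, since the
  coordinate fixing the direction is unchanged. The inverse undoes that step.\<close>

lemma off_square_bij:
  assumes "even m"
  shows "bij_betw (off_square m) ({1..m} \<times> {1..m}) ({1..m} \<times> {1..m})"
proof (rule bij_betw_byWitness[where f' = "\<lambda>(r, c). if odd r = odd c
    then (if odd r then cyc_pred m r else cyc_suc m r, c)
    else (r, if odd r then cyc_suc m c else cyc_pred m c)"])
qed (use assms in \<open>auto simp: off_square_def even_cyc_suc even_cyc_pred cyc_suc_pred cyc_pred_suc
    simp del: atLeastAtMost_iff One_nat_def split: if_splits intro: cyc_suc_in cyc_pred_in\<close>)

text \<open>Every edge is listed once, at its head in the raster orientation, with
  \<open>True\<close> for row edges and \<open>False\<close> for column edges. Two different heads
  of one row edge would lie in the same row, hence step in the same direction, and two such steps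
  would lead back to the start. Columns are alike.\<close>

lemma in_edges_bij:
  assumes "n \<ge> 2"
  shows "bij_betw (\<lambda>(v, b). {v, if b then row_in (2 * n) v else col_in (2 * n) v})
    (({1..2 * n} \<times> {1..2 * n}) \<times> UNIV) (edges (torus_grid n))"
    (is "bij_betw ?f (?V \<times> UNIV) _")
proof -
  let ?m = "2 * n"
  have m: "?m > 2" "?m > 1" using assms by auto
  have rowrow: "v = w" if "v \<in> ?V" "w \<in> ?V" "{v, row_in ?m v} = {w, row_in ?m w}" for v w
    using that cyc_suc_suc_neq[OF _ m(1)] cyc_pred_pred_neq[OF _ m(1)]
    by (cases v; cases w) (auto simp: doubleton_eq_iff simp del: atLeastAtMost_iff One_nat_def)
  have colcol: "v = w" if "v \<in> ?V" "w \<in> ?V" "{v, col_in ?m v} = {w, col_in ?m w}" for v w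
    using that cyc_suc_suc_neq[OF _ m(1)] cyc_pred_pred_neq[OF _ m(1)]
    by (cases v; cases w) (auto simp: doubleton_eq_iff simp del: atLeastAtMost_iff One_nat_def)
  have rowcol: "{v, row_in ?m v} \<noteq> {w, col_in ?m w}" if "v \<in> ?V" "w \<in> ?V" for v w
    using that cyc_suc_neq[OF m(2)] cyc_pred_neq[OF _ m(2)]
    by (cases v; cases w) (auto simp: doubleton_eq_iff simp del: atLeastAtMost_iff One_nat_def)
  have inj: "inj_on ?f (?V \<times> UNIV)"
  proof (rule inj_onI, clarsimp simp del: atLeastAtMost_iff One_nat_def)
    fix r c b r' c' b'
    assume V: "r \<in> {1..?m}" "c \<in> {1..?m}" "r' \<in> {1..?m}" "c' \<in> {1..?m}"
      and eq: "{(r, c), if b then row_in ?m (r, c) else col_in ?m (r, c)} =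
        {(r', c'), if b' then row_in ?m (r', c') else col_in ?m (r', c')}"
    have V': "(r, c) \<in> ?V" "(r', c') \<in> ?V" using V by auto
    show "r = r' \<and> c = c' \<and> b = b'"
      using eq rowrow[OF V'] colcol[OF V'] rowcol[OF V'] rowcol[OF V'(2,1)]
      by (cases b; cases b') (simp_all del: row_in.simps col_in.simps)
  qed
  have C: "{i, cyc_suc ?m i} \<in> edges (cycle_graph ?m)" if "i \<in> {1..?m}" for i
    using that unfolding cycle_graph_def ugraph.select_convs by blast
  have C': "{i, cyc_pred ?m i} \<in> edges (cycle_graph ?m)" if "i \<in> {1..?m}" for i
    using C[OF cyc_pred_in[OF that]] cyc_suc_pred[OF that] by (simp add: insert_commute)
  have V: "verts (cycle_graph ?m) = {1..?m}" by (simp add: cycle_graph_def)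
  have "?f ` (?V \<times> UNIV) = edges (torus_grid n)"
  proof (intro equalityI subsetI)
    fix e assume "e \<in> ?f ` (?V \<times> UNIV)"
    then obtain r c b where rc: "r \<in> {1..?m}" "c \<in> {1..?m}" and e: "e = ?f ((r, c), b)"
      by blast
    have row: "{(r, c), (r, c')} \<in> edges (torus_grid n)"
      if "{c, c'} \<in> edges (cycle_graph ?m)" for c'
      using that rc unfolding torus_grid_def box_product_def ugraph.select_convs V by blast
    have col: "{(r, c), (r', c)} \<in> edges (torus_grid n)"
      if "{r, r'} \<in> edges (cycle_graph ?m)" for r'
      using that rc unfolding torus_grid_def box_product_def ugraph.select_convs V by blast
    show "e \<in> edges (torus_grid n)"
      using row[OF C[OF rc(2)]] row[OF C'[OF rc(2)]] col[OF C[OF rc(1)]] col[OF C'[OF rc(1)]]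
      unfolding e by simp
  next
    fix e assume "e \<in> edges (torus_grid n)"
    then consider
        a b b' where "a \<in> {1..?m}" "{b, b'} \<in> edges (cycle_graph ?m)" "e = {(a, b), (a, b')}"
      | a a' b where "b \<in> {1..?m}" "{a, a'} \<in> edges (cycle_graph ?m)" "e = {(a, b), (a', b)}"
      unfolding torus_grid_def box_product_def ugraph.select_convs V by blast
    then consider
        r c where "r \<in> {1..?m}" "c \<in> {1..?m}" "e = {(r, c), (r, cyc_suc ?m c)}"
      | r c where "r \<in> {1..?m}" "c \<in> {1..?m}" "e = {(r, c), (cyc_suc ?m r, c)}"
    proof cases
      case (1 a b b')
      then obtain i where i: "i \<in> {1..?m}" "{b, b'} = {i, cyc_suc ?m i}"
        unfolding cycle_graph_def ugraph.select_convs by blast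
      \<comment> \<open>As an image of the unordered pair, \<open>e\<close> can be rewritten without
        deciding which of \<open>b\<close>, \<open>b'\<close> is \<open>i\<close>.\<close>
      have "e = Pair a ` {b, b'}" using 1(3) by simp
      with that(1)[OF 1(1) i(1)] show ?thesis unfolding i(2) by simp
    next
      case (2 a a' b)
      then obtain i where i: "i \<in> {1..?m}" "{a, a'} = {i, cyc_suc ?m i}"
        unfolding cycle_graph_def ugraph.select_convs by blast
      have "e = (\<lambda>a. (a, b)) ` {a, a'}" using 2(3) by simp
      with that(2)[OF i(1) 2(1)] show ?thesis unfolding i(2) by simp
    qed
    then show "e \<in> ?f ` (?V \<times> UNIV)"
    proof cases
      case 1
      \<comment> \<open>The witness is the head of the edge: the right end in an odd row, the left
        end in an even one, read cyclically.\<close>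
      have "e = ?f ((r, if odd r then cyc_suc ?m c else c), True)"
        using 1 by (auto simp: cyc_pred_suc simp del: atLeastAtMost_iff One_nat_def)
      then show ?thesis
        by (rule image_eqI) (use 1 cyc_suc_in in \<open>auto simp del: atLeastAtMost_iff One_nat_def\<close>)
    next
      case 2
      have "e = ?f ((if odd c then r else cyc_suc ?m r, c), False)"
        using 2 by (auto simp: cyc_pred_suc simp del: atLeastAtMost_iff One_nat_def)
      then show ?thesis
        by (rule image_eqI) (use 2 cyc_suc_in in \<open>auto simp del: atLeastAtMost_iff One_nat_def\<close>)
    qed
  qed
  with inj show ?thesis by (simp add: bij_betw_def)
qed

text \<open>Confirms that \<open>row_in\<close> and \<open>col_in\<close> yield tails of arcs into
  \<open>v\<close>; compatibility of the sunlet map reduces to this.\<close>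

lemma in_arcs_raster:
  assumes "v \<in> {1..2 * n} \<times> {1..2 * n}"
  shows "(row_in (2 * n) v, v) \<in> raster_orientation n"
    and "(col_in (2 * n) v, v) \<in> raster_orientation n"
proof -
  let ?m = "2 * n"
  obtain r c where v: "v = (r, c)" and rc: "r \<in> {1..?m}" "c \<in> {1..?m}"
    using assms by blast
  have arcs: "odd r \<Longrightarrow> ((r, c), (r, cyc_suc ?m c)) \<in> raster_orientation n"
      "even r \<Longrightarrow> ((r, cyc_suc ?m c), (r, c)) \<in> raster_orientation n"
      "odd c \<Longrightarrow> ((cyc_suc ?m r, c), (r, c)) \<in> raster_orientation n"
      "even c \<Longrightarrow> ((r, c), (cyc_suc ?m r, c)) \<in> raster_orientation n"
    if "r \<in> {1..?m}" "c \<in> {1..?m}" for r c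
    using that unfolding raster_orientation_def Let_def by blast+
  \<comment> \<open>The definition lists each arc at its end of smaller cyclic index. For odd
    \<open>r\<close> that end is the tail, so the arc is taken at the predecessor of
    \<open>c\<close>.\<close>
  show "(row_in ?m v, v) \<in> raster_orientation n"
    using arcs(1)[OF rc(1) cyc_pred_in[OF rc(2)]] arcs(2)[OF rc] cyc_suc_pred[OF rc(2)]
    by (simp add: v)
  show "(col_in ?m v, v) \<in> raster_orientation n"
    using arcs(4)[OF cyc_pred_in[OF rc(1)] rc(2)] arcs(3)[OF rc] cyc_suc_pred[OF rc(1)]
    by (simp add: v)
qed

section \<open>Rims and pendant edges at the corners of odd squares\<close>

lemma atLeastAtMost_1_4: "{1..4} = {1, 2, 3, 4::nat}"
  by auto

text \<open>Corners 1 and 3 have coordinates of equal parity, corners 2 and 4 do not. So at odd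
  corners the rim arrives along a column and the pendant edge along a row, and at even corners the
  other way round.\<close>

lemma in_rim_pos:
  assumes "i \<in> {1..4}"
  shows "odd i \<Longrightarrow> col_in (2 * n) (rim_pos n (j, i)) = rim_pos n (j, cyc_pred 4 i)"
    and "even i \<Longrightarrow> row_in (2 * n) (rim_pos n (j, i)) = rim_pos n (j, cyc_pred 4 i)"
    and "off_square (2 * n) (rim_pos n (j, i)) =
      (if odd i then row_in (2 * n) (rim_pos n (j, i)) else col_in (2 * n) (rim_pos n (j, i)))"
proof -
  have "i = 1 \<or> i = 2 \<or> i = 3 \<or> i = 4" using assms by auto
  \<comment> \<open>The successor wraps only at \<open>2 * n\<close>, which is even, so a step from
    an odd index stays inside its square.\<close>
  moreover have "2 * k + 1 \<noteq> 2 * n" "Suc (2 * k) \<noteq> 2 * n" for k by presburger+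
  ultimately show "odd i \<Longrightarrow> col_in (2 * n) (rim_pos n (j, i)) = rim_pos n (j, cyc_pred 4 i)"
    and "even i \<Longrightarrow> row_in (2 * n) (rim_pos n (j, i)) = rim_pos n (j, cyc_pred 4 i)"
    and "off_square (2 * n) (rim_pos n (j, i)) =
      (if odd i then row_in (2 * n) (rim_pos n (j, i)) else col_in (2 * n) (rim_pos n (j, i)))"
    by (auto simp: rim_pos_def cyc_pred_def cyc_suc_def off_square_def)
qed

section \<open>Vertices and edges of the sunlets and of the odd squares\<close>

lemma verts_sunlet_cycle: "verts (copies N (sunlet_cycle 4)) = {1..N} \<times> Rim ` {1..4}"
  by (simp add: copies_def sunlet_cycle_def cycle_graph_def)

lemma verts_sunlet: "verts (copies N (sunlet 4)) = {1..N} \<times> (Rim ` {1..4} \<union> Leaf ` {1..4})"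
  by (simp add: copies_def sunlet_def sunlet_cycle_def cycle_graph_def)

lemma edges_sunlet_cycle_4:
  "edges (sunlet_cycle 4) = {{Rim 1, Rim 2}, {Rim 2, Rim 3}, {Rim 3, Rim 4}, {Rim 4, Rim 1}}"
  unfolding sunlet_cycle_def cycle_graph_def atLeastAtMost_1_4 Setcompr_eq_image
  by (simp add: cyc_suc_def eval_nat_numeral)

lemma edges_sunlet_4:
  "edges (sunlet 4) = (\<Union>i\<in>{1..4}. {{Rim i, Leaf i}, {Rim i, Rim (cyc_pred 4 i)}})"
  unfolding sunlet_def edges_sunlet_cycle_4 atLeastAtMost_1_4 Setcompr_eq_image
  by (simp add: cyc_pred_def insert_commute)

lemma edges_copies: "edges (copies N G) = (\<Union>j\<in>{1..N}. (`) (Pair j) ` edges G)"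
  unfolding copies_def ugraph.select_convs by blast

text \<open>Each edge is listed at its head in the FSM orientation. The test
  \<open>b = odd i\<close> is chosen so that \<open>b\<close> says whether the image is a row edge,
  matching the index set of \<open>in_edges_bij\<close>.\<close>

lemma edges_sunlet:
  "edges (copies N (sunlet 4)) =
    (\<lambda>((j, i), b). {(j, Rim i), (j, if b = odd i then Leaf i else Rim (cyc_pred 4 i))})
      ` (({1..N} \<times> {1..4}) \<times> UNIV)"
proof -
  have image_bool: "(\<lambda>((j, i), b). g j i b) ` ((J \<times> I) \<times> UNIV) =
      (\<Union>j\<in>J. \<Union>i\<in>I. {g j i True, g j i False})"
    for g :: "nat \<Rightarrow> nat \<Rightarrow> bool \<Rightarrow> (nat \<times> sunlet_vertex) set" and J I
  proof (intro equalityI subsetI)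
    fix e assume "e \<in> (\<lambda>((j, i), b). g j i b) ` ((J \<times> I) \<times> UNIV)"
    then obtain j i b where "j \<in> J" "i \<in> I" "e = g j i b" by auto
    then show "e \<in> (\<Union>j\<in>J. \<Union>i\<in>I. {g j i True, g j i False})" by (cases b) auto
  next
    fix e assume "e \<in> (\<Union>j\<in>J. \<Union>i\<in>I. {g j i True, g j i False})"
    then obtain j i b where "j \<in> J" "i \<in> I" "e = g j i b" by blast
    then show "e \<in> (\<lambda>((j, i), b). g j i b) ` ((J \<times> I) \<times> UNIV)"
      by (intro image_eqI[of _ _ "((j, i), b)"]) simp_all
  qed
  let ?g = "\<lambda>j i b. {(j, Rim i), (j, if b = odd i then Leaf i else Rim (cyc_pred 4 i))}"
  have "edges (copies N (sunlet 4)) =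
      (\<Union>j\<in>{1..N}. \<Union>i\<in>{1..4}. {{(j, Rim i), (j, Leaf i)}, {(j, Rim i), (j, Rim (cyc_pred 4 i))}})"
    unfolding edges_copies edges_sunlet_4 image_UN by (simp only: image_insert image_empty)
  also have "\<dots> = (\<Union>j\<in>{1..N}. \<Union>i\<in>{1..4}. {?g j i True, ?g j i False})"
  proof (intro SUP_cong refl)
    fix j i :: nat
    show "{{(j, Rim i), (j, Leaf i)}, {(j, Rim i), (j, Rim (cyc_pred 4 i))}} =
        {?g j i True, ?g j i False}"
      by (cases "odd i") (simp_all add: insert_commute)
  qed
  finally show ?thesis unfolding image_bool .
qed

lemma edges_odd_square:
  "edges (odd_square k l) =
    {{(2 * k + 1, 2 * l + 1), (2 * k + 1, 2 * l + 2)},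
     {(2 * k + 1, 2 * l + 2), (2 * k + 2, 2 * l + 2)},
     {(2 * k + 2, 2 * l + 2), (2 * k + 2, 2 * l + 1)},
     {(2 * k + 2, 2 * l + 1), (2 * k + 1, 2 * l + 1)}}"
proof -
  have rows: "{{(a, b), (a, b')} | a b b'. a \<in> A \<and> {b, b'} \<in> {{s, t}}} =
      (\<lambda>a. {(a, s), (a, t)}) ` A" for A and s t :: nat
  proof (intro equalityI subsetI)
    fix e assume "e \<in> {{(a, b), (a, b')} | a b b'. a \<in> A \<and> {b, b'} \<in> {{s, t}}}"
    then obtain a b b' where e: "a \<in> A" "{b, b'} = {s, t}" "e = {(a, b), (a, b')}" by blast
    from e(3) have "e = Pair a ` {b, b'}" by simp
    then show "e \<in> (\<lambda>a. {(a, s), (a, t)}) ` A" using e(1) unfolding e(2) by simp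
  qed blast
  have cols: "{{(a, b), (a', b)} | a a' b. {a, a'} \<in> {{p, q}} \<and> b \<in> B} =
      (\<lambda>b. {(p, b), (q, b)}) ` B" for B and p q :: nat
  proof (intro equalityI subsetI)
    fix e assume "e \<in> {{(a, b), (a', b)} | a a' b. {a, a'} \<in> {{p, q}} \<and> b \<in> B}"
    then obtain a a' b where e: "b \<in> B" "{a, a'} = {p, q}" "e = {(a, b), (a', b)}" by blast
    from e(3) have "e = (\<lambda>a. (a, b)) ` {a, a'}" by simp
    then show "e \<in> (\<lambda>b. {(p, b), (q, b)}) ` B" using e(1) unfolding e(2) by simp
  qed blast
  show ?thesis
    unfolding odd_square_def box_product_def odd_edge_def ugraph.select_convs rows cols
    by (simp add: insert_commute)
qed

lemma verts_odd_squares: "verts (odd_squares n) = {1..2 * n} \<times> {1..2 * n}"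
proof -
  have "(\<Union>k<n. {2 * k + 1, 2 * k + 2}) = {1..2 * n}"
  proof (intro equalityI subsetI)
    fix r assume "r \<in> {1..2 * n}"
    then have "(r - 1) div 2 < n" "r = 2 * ((r - 1) div 2) + 1 \<or> r = 2 * ((r - 1) div 2) + 2"
      by simp_all presburger+
    then show "r \<in> (\<Union>k<n. {2 * k + 1, 2 * k + 2})" by blast
  qed auto
  moreover have "verts (odd_squares n) =
      (\<Union>k<n. {2 * k + 1, 2 * k + 2}) \<times> (\<Union>l<n. {2 * l + 1, 2 * l + 2})"
    unfolding odd_squares_def odd_square_def box_product_def odd_edge_def by auto
  ultimately show ?thesis by simp
qed

text \<open>Copy \<open>j\<close> is wrapped around the square given by the digits of
  \<open>j - 1\<close>, and by \<open>index_bij\<close> these run over all squares.\<close>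

lemma edges_odd_squares:
  "edges (odd_squares n) = (`) (sunlet_map n) ` edges (copies (n\<^sup>2) (sunlet_cycle 4))"
proof -
  have sq: "(\<lambda>e. sunlet_map n ` Pair j ` e) ` edges (sunlet_cycle 4) =
      edges (odd_square ((j - 1) div n) ((j - 1) mod n))" for j
    unfolding edges_sunlet_cycle_4 edges_odd_square by (simp add: rim_pos_def)
  have "(`) (sunlet_map n) ` edges (copies (n\<^sup>2) (sunlet_cycle 4)) =
      (\<Union>j\<in>{1..n\<^sup>2}. (\<lambda>e. sunlet_map n ` Pair j ` e) ` edges (sunlet_cycle 4))"
    unfolding edges_copies by blast
  also have "\<dots> =
      (\<Union>(k, l)\<in>(\<lambda>j. ((j - 1) div n, (j - 1) mod n)) ` {1..n\<^sup>2}. edges (odd_square k l))"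
    unfolding sq by simp
  also have "\<dots> = edges (odd_squares n)"
    unfolding bij_betw_imp_surj_on[OF index_bij] odd_squares_def by auto
  finally show ?thesis ..
qed

section \<open>Fibres and isomorphisms\<close>

lemma Collect_image_Un:
  "{v \<in> f ` A \<union> g ` B. P v} = f ` {x \<in> A. P (f x)} \<union> g ` {x \<in> B. P (g x)}"
  by blast

lemma bij_betw_fibre: "bij_betw f A B \<Longrightarrow> w \<in> B \<Longrightarrow> \<exists>x. {x \<in> A. f x = w} = {x}"
  by (auto simp: bij_betw_def inj_on_def)

text \<open>A map injective on vertices is injective on sets of vertices, so an edge of
  \<open>H\<close> between images can only come from the edge of \<open>G\<close> between the
  originals.\<close>

lemma graph_isoI:
  assumes bij: "bij_betw \<phi> (verts G) (verts H)"
    and edges: "edges H = (`) \<phi> ` edges G" "\<And>e. e \<in> edges G \<Longrightarrow> e \<subseteq> verts G"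
  shows "graph_iso G H \<phi>"
  unfolding graph_iso_def
proof (intro conjI bij ballI iffI)
  fix u v assume uv: "u \<in> verts G" "v \<in> verts G"
  show "{\<phi> u, \<phi> v} \<in> edges H" if "{u, v} \<in> edges G"
    using imageI[OF that, of "(`) \<phi>"] by (simp add: edges(1))
  assume "{\<phi> u, \<phi> v} \<in> edges H"
  then obtain e where e: "e \<in> edges G" "\<phi> ` {u, v} = \<phi> ` e"
    unfolding edges(1) by auto
  then have "{u, v} = e"
    using inj_on_image_eq_iff[OF bij_betw_imp_inj_on[OF bij], of "{u, v}" e] edges(2) uv by auto
  with e(1) show "{u, v} \<in> edges G" by simp
qed

theorem theorem3:
  fixes n :: nat
  assumes "n \<ge> 2"
  shows "\<exists>\<phi> :: nat \<times> sunlet_vertex \<Rightarrow> nat \<times> nat.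
    graph_hom (copies (n\<^sup>2) (sunlet 4)) (torus_grid n) \<phi> \<and>
    covering (copies (n\<^sup>2) (sunlet 4)) (torus_grid n) \<phi> \<and>
    two_to_one (copies (n\<^sup>2) (sunlet 4)) (torus_grid n) \<phi> \<and>
    graph_iso (copies (n\<^sup>2) (sunlet_cycle 4)) (odd_squares n) \<phi> \<and>
    compatible (copies_arcs (n\<^sup>2) (fsm_orientation 4)) (raster_orientation n) \<phi>"
proof (intro exI[of _ "sunlet_map n"] conjI)
  let ?m = "2 * n" and ?X = "{1..n\<^sup>2} \<times> {1..4::nat}" and ?\<phi> = "sunlet_map n"
  let ?V = "{1..?m} \<times> {1..?m}" and ?G = "copies (n\<^sup>2) (sunlet 4)"
  let ?e = "\<lambda>((j, i), b). {(j, Rim i), (j, if b = odd i then Leaf i else Rim (cyc_pred 4 i))}"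
  let ?in = "\<lambda>(v, b). {v, if b then row_in ?m v else col_in ?m v}"
  have rim: "bij_betw (rim_pos n) ?X ?V" by (rule rim_pos_bij)
  have leaf: "bij_betw (off_square ?m \<circ> rim_pos n) ?X ?V"
    using rim off_square_bij by (rule bij_betw_trans) simp
  have V: "verts (torus_grid n) = ?V"
    by (simp add: torus_grid_def box_product_def cycle_graph_def)

  \<comment> \<open>The map carries the edge with index \<open>((j, i), b)\<close> to the in-edge of
    type \<open>b\<close> at corner \<open>i\<close> of the square, so it matches the two edge
    listings.\<close>
  have img: "?\<phi> ` ?e x = ?in (map_prod (rim_pos n) id x)" if x: "x \<in> ?X \<times> UNIV" for x
  proof -
    obtain j i b where "x = ((j, i), b)" "i \<in> {1..4}" using x by auto
    then show ?thesis
      using in_rim_pos[of i n j] by (cases b; cases "odd i") auto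
  qed
  have "bij_betw (map_prod (rim_pos n) (id :: bool \<Rightarrow> bool)) (?X \<times> UNIV) (?V \<times> UNIV)"
    using rim by (intro bij_betw_map_prod) auto
  then have "bij_betw (?in \<circ> map_prod (rim_pos n) id) (?X \<times> UNIV) (edges (torus_grid n))"
    using in_edges_bij[OF assms] by (rule bij_betw_trans)
  then have comp: "bij_betw ((`) ?\<phi> \<circ> ?e) (?X \<times> UNIV) (edges (torus_grid n))"
    by (subst bij_betw_cong[where g = "?in \<circ> map_prod (rim_pos n) id"])
      (simp_all only: img o_apply)
  show covering: "covering ?G (torus_grid n) ?\<phi>"
    using comp unfolding covering_def edges_sunlet bij_betw_def
    by (auto simp only: image_comp intro: inj_on_imageI)

  show "graph_hom ?G (torus_grid n) ?\<phi>"
    unfolding graph_hom_def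
  proof
    show "?\<phi> ` verts ?G \<subseteq> verts (torus_grid n)"
    proof (rule image_subsetI)
      fix x assume "x \<in> verts ?G"
      then obtain j i where ji: "(j, i) \<in> ?X" and x: "x = (j, Rim i) \<or> x = (j, Leaf i)"
        unfolding verts_sunlet by blast
      show "?\<phi> x \<in> verts (torus_grid n)"
        using x bij_betwE[OF rim, rule_format, OF ji] bij_betwE[OF leaf, rule_format, OF ji]
        unfolding V by (elim disjE) simp_all
    qed
    show "\<forall>e\<in>edges ?G. ?\<phi> ` e \<in> edges (torus_grid n)"
      using covering unfolding covering_def by (blast dest: bij_betwE)
  qed

  show "two_to_one ?G (torus_grid n) ?\<phi>"
    unfolding two_to_one_def V
  proof
    fix w assume w: "w \<in> ?V"
    \<comment> \<open>One preimage of \<open>w\<close> is a rim vertex and one is a leaf. They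
      differ by constructor even if \<open>x = y\<close>.\<close>
    obtain x y where x: "{x \<in> ?X. rim_pos n x = w} = {x}"
      and y: "{x \<in> ?X. (off_square ?m \<circ> rim_pos n) x = w} = {y}"
      using bij_betw_fibre[OF rim w] bij_betw_fibre[OF leaf w] by blast
    have \<phi>: "?\<phi> (map_prod id Rim x) = rim_pos n x"
        "?\<phi> (map_prod id Leaf x) = (off_square ?m \<circ> rim_pos n) x" for x
      by (cases x; simp)+
    have "verts ?G = map_prod id Rim ` ?X \<union> map_prod id Leaf ` ?X"
      unfolding verts_sunlet by (simp add: map_prod_surj_on[OF image_ident refl, folded id_def] Sigma_Un_distrib2)
    then have "{v \<in> verts ?G. ?\<phi> v = w} =
        map_prod id Rim ` {x \<in> ?X. ?\<phi> (map_prod id Rim x) = w}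
        \<union> map_prod id Leaf ` {x \<in> ?X. ?\<phi> (map_prod id Leaf x) = w}"
      by (simp only: Collect_image_Un)
    also have "\<dots> = {map_prod id Rim x, map_prod id Leaf y}"
      unfolding \<phi> x y by auto
    also have "card \<dots> = 2"
      by (cases x; cases y) simp
    finally show "card {v \<in> verts ?G. ?\<phi> v = w} = 2" .
  qed

  show "graph_iso (copies (n\<^sup>2) (sunlet_cycle 4)) (odd_squares n) ?\<phi>"
  proof (rule graph_isoI)
    have Rim: "bij_betw (map_prod id Rim) ?X (verts (copies (n\<^sup>2) (sunlet_cycle 4)))"
      unfolding verts_sunlet_cycle
      by (intro bij_betw_map_prod) (auto simp: bij_betw_def inj_on_def)
    have "?\<phi> \<circ> map_prod id Rim = rim_pos n"
      by (auto simp: fun_eq_iff)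
    then show "bij_betw ?\<phi> (verts (copies (n\<^sup>2) (sunlet_cycle 4))) (verts (odd_squares n))"
      using rim unfolding bij_betw_comp_iff[OF Rim] verts_odd_squares by simp
    fix e assume "e \<in> edges (copies (n\<^sup>2) (sunlet_cycle 4))"
    then obtain j e' where "j \<in> {1..n\<^sup>2}" "e' \<in> edges (sunlet_cycle 4)" "e = Pair j ` e'"
      unfolding edges_copies by blast
    then show "e \<subseteq> verts (copies (n\<^sup>2) (sunlet_cycle 4))"
      unfolding verts_sunlet_cycle edges_sunlet_cycle_4 by auto
  qed (rule edges_odd_squares)

  have arc: "(?\<phi> (j, Rim (cyc_pred 4 i)), ?\<phi> (j, Rim i)) \<in> raster_orientation n"
      "(?\<phi> (j, Leaf i), ?\<phi> (j, Rim i)) \<in> raster_orientation n"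
    if ji: "j \<in> {1..n\<^sup>2}" "i \<in> {1..4}" for j i
  proof -
    have "rim_pos n (j, i) \<in> ?V"
      using bij_betwE[OF rim] ji by blast
    note arcs = in_arcs_raster[OF this] in_rim_pos[OF ji(2), of n j]
    show "(?\<phi> (j, Rim (cyc_pred 4 i)), ?\<phi> (j, Rim i)) \<in> raster_orientation n"
      using arcs by (cases "odd i") simp_all
    show "(?\<phi> (j, Leaf i), ?\<phi> (j, Rim i)) \<in> raster_orientation n"
      using arcs by (cases "odd i") simp_all
  qed
  \<comment> \<open>Rim arcs are given by their tail in \<open>fsm_orientation\<close> but by their
    head in \<open>arc\<close>, hence the instance at \<open>cyc_suc\<close>.\<close>
  show "compatible (copies_arcs (n\<^sup>2) (fsm_orientation 4)) (raster_orientation n) ?\<phi>"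
    unfolding compatible_def copies_arcs_def fsm_orientation_def
    using arc(2) arc(1)[OF _ cyc_suc_in]
    by (auto simp: cyc_pred_suc simp del: atLeastAtMost_iff One_nat_def sunlet_map.simps)
qed

end
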